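(* Let $\mu$ be an ordinal with $1\le\mu<\omega_1$ and $S\subseteq\mathbb{N}^\mathbb{N}$. Then $S$ is $\mu$th-order guessable if and only if $S\in\boldsymbol{\Delta}^0_{\mu+1}$.
   Context: $\mathbb{N}^\mathbb{N}$ carries the Baire space topology and $\boldsymbol{\Delta}^0_\xi$ denotes the usual boldface Borel class on it. $\chi_X$ is the characteristic function of $X$; $\{0,1\}^{<\mathbb{N}}$ is the set of finite binary sequences, and $s\upharpoonright n$ the length-$n$ initial segment of $s$. For a sequence $\mathscr{S}=(S_0,S_1,\ldots)$ of subsets of $\mathbb{N}^\mathbb{N}$ and $f\in\mathbb{N}^\mathbb{N}$, let $\mathscr{S}(f)=(\chi_{S_0}(f),\chi_{S_1}(f),\ldots)\in\{0,1\}^\mathbb{N}$. $S$ is guessable based on $\mathscr{S}$ if there is $G:\{0,1\}^{<\mathbb{N}}\to\{0,1\}$ such that for all $f\in\mathbb{N}^\mathbb{N}$, $\lim_{n\to\infty}G(\mathscr{S}(f)\upharpoonright n)=\chi_S(f)$. $S$ is $\mu$th-order guessable if there is such a sequence $\mathscr{S}=(S_0,S_1,\ldots)$ with $S$ guessable based on $\mathscr{S}$ and, for each $i$, $S_i\in\boldsymbol{\Delta}^0_{\mu_i+1}$ for some $\mu_i<\mu$. *)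

theory Defs
  imports "HOL-Analysis.Analysis"
begin

section \<open>Countable ordinals\<close>

text \<open>
  The elements of the first uncountable cardinal, well-ordered by it, serve as the ordinals
  below \<open>\<omega>\<^sub>1\<close>.  The lemmas \<open>countable_below\<close> and \<open>uncountable_omega1\<close> below, together with the
  \<open>wellorder\<close> instance, determine the order type.
\<close>

typedef omega1 = "Field (cardSuc natLeq)"
proof -
  have "infinite (Field (cardSuc natLeq))"
    using cardSuc_finite[OF natLeq_Card_order] by (simp add: Field_natLeq)
  then show ?thesis
    by (metis equals0I finite.emptyI)
qed

lemma Card_order_cardSuc_natLeq: "Card_order (cardSuc natLeq)"
  by (simp add: cardSuc_Card_order natLeq_Card_order)

lemma Well_order_cardSuc_natLeq: "Well_order (cardSuc natLeq)"
  using Card_order_cardSuc_natLeq card_order_on_well_order_on by blast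

instantiation omega1 :: wellorder
begin

definition less_eq_omega1 :: "omega1 \<Rightarrow> omega1 \<Rightarrow> bool" where
  "a \<le> b \<longleftrightarrow> (Rep_omega1 a, Rep_omega1 b) \<in> cardSuc natLeq"

definition less_omega1 :: "omega1 \<Rightarrow> omega1 \<Rightarrow> bool" where
  "(a :: omega1) < b \<longleftrightarrow> a \<le> b \<and> a \<noteq> b"

instance
proof -
  let ?r = "cardSuc natLeq"
  have refl: "refl_on (Field ?r) ?r" and tr: "trans ?r" and anti: "antisym ?r"
    and tot: "total_on (Field ?r) ?r" and wf: "wf (?r - Id)"
    using Well_order_cardSuc_natLeq
    by (auto simp: well_order_on_def linear_order_on_def partial_order_on_def preorder_on_def)
  have antiR: "a = b" if "a \<le> b" "b \<le> a" for a b :: omega1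
    using that anti by (metis Rep_omega1_inject antisymD less_eq_omega1_def)
  have eqR: "a \<le> a" for a :: omega1
    using refl Rep_omega1 by (simp add: less_eq_omega1_def refl_onD)
  have wfless: "wf {(a, b :: omega1). a < b}"
  proof (rule wf_subset)
    show "wf (inv_image (?r - Id) Rep_omega1)"
      using wf by (rule wf_inv_image)
    show "{(a, b :: omega1). a < b} \<subseteq> inv_image (?r - Id) Rep_omega1"
      by (auto simp: inv_image_def less_omega1_def less_eq_omega1_def Rep_omega1_inject)
  qed
  show "OFCLASS(omega1, wellorder_class)"
  proof
    fix a b c :: omega1
    show "a < b \<longleftrightarrow> a \<le> b \<and> \<not> b \<le> a"
      using antiR eqR by (auto simp: less_omega1_def)
    show "a \<le> a"
      by (rule eqR)
    show "a \<le> b \<Longrightarrow> b \<le> c \<Longrightarrow> a \<le> c"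
      using tr by (auto simp: less_eq_omega1_def elim: transE)
    show "a \<le> b \<Longrightarrow> b \<le> a \<Longrightarrow> a = b"
      by (rule antiR)
    show "a \<le> b \<or> b \<le> a"
      using tot eqR Rep_omega1[of a] Rep_omega1[of b]
      by (metis Rep_omega1_inject less_eq_omega1_def total_on_def)
  next
    fix P :: "omega1 \<Rightarrow> bool" and a
    assume "\<And>x. (\<And>y. y < x \<Longrightarrow> P y) \<Longrightarrow> P x"
    then show "P a"
      using wf_induct_rule[OF wfless, of P a] by auto
  qed
qed

end

lemma countable_below: "countable {..<a :: omega1}"
proof -
  include cardinal_syntax
  let ?r = "cardSuc natLeq"
  let ?U = "underS ?r (Rep_omega1 a)"
  have "|?U| <o ?r"
    using Card_order_cardSuc_natLeq Rep_omega1 by (rule card_of_underS)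
  then have "|?U| \<le>o natLeq"
    using cardSuc_ordLeq_ordLess[OF natLeq_Card_order card_of_Card_order] by blast
  then have "|?U| \<le>o |UNIV :: nat set|"
    using card_of_nat ordIso_symmetric ordLeq_ordIso_trans by blast
  then have "countable ?U"
    by (metis card_of_ordLeq countableI)
  moreover have "Rep_omega1 ` {..<a} \<subseteq> ?U"
    by (auto simp: underS_def less_omega1_def less_eq_omega1_def Rep_omega1_inject)
  ultimately have "countable (Rep_omega1 ` {..<a})"
    using countable_subset by blast
  then show ?thesis
    by (rule countable_image_inj_on) (simp add: inj_on_def Rep_omega1_inject)
qed

lemma uncountable_omega1: "uncountable (UNIV :: omega1 set)"
proof
  include cardinal_syntax
  let ?r = "cardSuc natLeq"
  assume "countable (UNIV :: omega1 set)"
  then have "countable (Field ?r)"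
    using type_definition.Rep_range[OF type_definition_omega1] countable_image by metis
  then have "|Field ?r| \<le>o |UNIV :: nat set|"
    using card_of_ordLeq[of "Field ?r" "UNIV :: nat set"] by (auto elim!: countableE)
  then have "|Field ?r| \<le>o natLeq"
    using card_of_nat ordLeq_ordIso_trans by blast
  then have "?r \<le>o natLeq"
    using card_of_Field_ordIso[OF Card_order_cardSuc_natLeq] ordIso_symmetric
      ordIso_ordLeq_trans by blast
  moreover have "natLeq <o ?r"
    by (simp add: cardSuc_greater natLeq_Card_order)
  ultimately show False
    using not_ordLess_ordLeq by blast
qed

definition osuc :: "omega1 \<Rightarrow> omega1" where
  "osuc a = (LEAST b. a < b)"

lemma less_osuc: "a < osuc a"
proof -
  have "\<exists>b. a < b"
  proof (rule ccontr)
    assume "\<nexists>b. a < b"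
    then have "(UNIV :: omega1 set) = insert a {..<a}"
      by (auto simp: not_less order.order_iff_strict)
    then show False
      using countable_below[of a] uncountable_omega1 by (metis countable_insert)
  qed
  then show ?thesis
    unfolding osuc_def by (rule LeastI_ex)
qed

lemma osuc_le_iff: "osuc a \<le> b \<longleftrightarrow> a < b"
  using less_osuc[of a] by (auto simp: osuc_def intro: Least_le)

instantiation omega1 :: "{zero, one}"
begin

definition zero_omega1 :: omega1 where
  "0 = (LEAST a :: omega1. True)"

definition one_omega1 :: omega1 where
  "1 = osuc (0 :: omega1)"

instance ..

end

section \<open>The boldface Borel hierarchy\<close>

text \<open>
  The classes are indexed from 1: there is no rule with index 0, so \<open>Sigma0 0\<close> is empty.
  In the second rule \<open>- A n \<in> \<Sigma>\<^sup>0\<close> says that \<open>A n\<close> is in \<open>\<Pi>\<^sup>0\<close>.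
\<close>

inductive is_Sigma0 :: "omega1 \<Rightarrow> 'a::topological_space set \<Rightarrow> bool" where
  is_Sigma0_open: "open A \<Longrightarrow> is_Sigma0 1 A"
| is_Sigma0_Union: "1 < \<xi> \<Longrightarrow> (\<And>n::nat. 1 \<le> \<eta> n \<and> \<eta> n < \<xi> \<and> is_Sigma0 (\<eta> n) (- A n))
    \<Longrightarrow> is_Sigma0 \<xi> (\<Union>n. A n)"

definition Sigma0 :: "omega1 \<Rightarrow> 'a::topological_space set set" where
  "Sigma0 \<xi> = {A. is_Sigma0 \<xi> A}"

definition Pi0 :: "omega1 \<Rightarrow> 'a::topological_space set set" where
  "Pi0 \<xi> = {A. - A \<in> Sigma0 \<xi>}"

definition Delta0 :: "omega1 \<Rightarrow> 'a::topological_space set set" where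
  "Delta0 \<xi> = Sigma0 \<xi> \<inter> Pi0 \<xi>"

section \<open>Guessability\<close>

text \<open>
  Baire space is the type \<open>nat \<Rightarrow> nat\<close>, whose \<open>topological_space\<close> instance is the product of
  discrete topologies.  The set \<open>{0,1}\<close> is the type \<open>bool\<close>, which is discrete, so characteristic
  functions are membership predicates, \<open>{0,1}\<close>-valued finite sequences are lists of booleans,
  and limits are taken in \<open>bool\<close>.
\<close>

definition char_fun :: "(nat \<Rightarrow> nat) set \<Rightarrow> (nat \<Rightarrow> nat) \<Rightarrow> bool" where
  "char_fun X f \<longleftrightarrow> f \<in> X"

definition char_seq :: "(nat \<Rightarrow> (nat \<Rightarrow> nat) set) \<Rightarrow> (nat \<Rightarrow> nat) \<Rightarrow> nat \<Rightarrow> bool" where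
  "char_seq \<S> f = (\<lambda>i. char_fun (\<S> i) f)"

definition initial_segment :: "(nat \<Rightarrow> 'a) \<Rightarrow> nat \<Rightarrow> 'a list" where
  "initial_segment s n = map s [0..<n]"

definition guessable_based_on ::
    "(nat \<Rightarrow> nat) set \<Rightarrow> (nat \<Rightarrow> (nat \<Rightarrow> nat) set) \<Rightarrow> bool" where
  "guessable_based_on S \<S> \<longleftrightarrow>
    (\<exists>G :: bool list \<Rightarrow> bool. \<forall>f.
      (\<lambda>n. G (initial_segment (char_seq \<S> f) n)) \<longlonglongrightarrow> char_fun S f)"

definition guessable_of_order :: "omega1 \<Rightarrow> (nat \<Rightarrow> nat) set \<Rightarrow> bool" where
  "guessable_of_order \<mu> S \<longleftrightarrow>
    (\<exists>\<S>. guessable_based_on S \<S> \<and> (\<forall>i. \<exists>\<nu><\<mu>. \<S> i \<in> Delta0 (osuc \<nu>)))"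

end

theory Submission
  imports Defs
begin

text \<open>
  If \<open>G\<close> guesses \<open>S\<close>, then \<open>f \<in> S\<close> iff \<open>G\<close> eventually answers yes on \<open>f\<close>; each single answer depends
  on finitely many of the \<open>S\<^sub>i\<close>, so \<open>S\<close> and its complement are countable unions of \<open>\<Pi>\<^sup>0\<^sub>\<mu>\<close> sets.
  Conversely, write \<open>S\<close> and its complement as countable unions of sets \<open>E\<^sub>i\<close> (\<open>i\<close> even, respectively odd),
  each \<open>E\<^sub>i\<close> being a countable intersection of sets from classes \<open>\<Delta>\<^sup>0\<^bsub>\<nu>+1\<^esub>\<close> with \<open>\<nu> < \<mu>\<close>.
  Guess according to the parity of the least \<open>i\<close> for which the data seen so far have not
  refuted \<open>f \<in> E\<^sub>i\<close>; this index stabilises at the least \<open>i\<close> with \<open>f \<in> E\<^sub>i\<close>.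
\<close>

section \<open>Order facts about countable ordinals\<close>

lemma zero_le_omega1 [simp]: "(0::omega1) \<le> a"
  by (simp add: zero_omega1_def Least_le)

lemma one_le_iff_omega1: "(1::omega1) \<le> a \<longleftrightarrow> 0 < a"
  by (simp add: one_omega1_def osuc_le_iff)

lemma less_osuc_iff: "a < osuc b \<longleftrightarrow> a \<le> b"
  by (metis osuc_le_iff not_less)

lemma one_le_osuc [simp]: "(1::omega1) \<le> osuc a"
  by (simp add: one_le_iff_omega1 less_osuc_iff)

section \<open>Closure properties of the Borel classes\<close>

lemma is_Sigma0_one_le: "is_Sigma0 \<xi> A \<Longrightarrow> 1 \<le> \<xi>"
  by (induction rule: is_Sigma0.induct) auto

lemma is_Sigma0_one_iff: "is_Sigma0 1 A \<longleftrightarrow> open A"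
  by (auto intro: is_Sigma0_open elim: is_Sigma0.cases)

lemma is_Sigma0_gt_one_cases:
  assumes "is_Sigma0 \<xi> A" "1 < \<xi>"
  obtains B \<eta> where "A = (\<Union>n::nat. B n)"
    "\<And>n. 1 \<le> \<eta> n" "\<And>n. \<eta> n < \<xi>" "\<And>n. is_Sigma0 (\<eta> n) (- B n)"
  using assms by (cases rule: is_Sigma0.cases) auto

lemma is_Sigma0_compl:
  assumes "is_Sigma0 \<eta> (- A)" "\<eta> < \<xi>"
  shows "is_Sigma0 \<xi> A"
proof -
  have "is_Sigma0 \<xi> (\<Union>n::nat. A)"
    using assms is_Sigma0_one_le[OF assms(1)] by (intro is_Sigma0_Union[where \<eta> = "\<lambda>_. \<eta>"]) auto
  then show ?thesis by simp
qed

text \<open>Basic open boxes are intersections of coordinate preimages of sets of naturals, so they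
  are also closed. The fact fixes both base cases at index 1: monotonicity of the hierarchy and the
  decomposition into lower ambiguous sets.\<close>

lemma open_eq_Union_clopen:
  fixes A :: "(nat \<Rightarrow> nat) set"
  assumes "open A"
  obtains C :: "nat \<Rightarrow> (nat \<Rightarrow> nat) set" where "\<And>n. open (C n)" "\<And>n. closed (C n)" "A = (\<Union>n. C n)"
proof -
  obtain K :: "(nat \<Rightarrow> nat) set set" where K: "topological_basis K" "countable K"
    "\<And>k. k \<in> K \<Longrightarrow> \<exists>X. k = Pi\<^sub>E UNIV X"
    using product_topology_countable_basis by metis
  obtain L where L: "L \<subseteq> K" "\<Union>L = A"
    using K(1) assms unfolding topological_basis_def by blast
  have closed: "closed k" if k: "k \<in> K" for k
  proof -
    obtain X where X: "k = Pi\<^sub>E UNIV X" using K(3) k by blast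
    have "closed ((\<lambda>f. f i) -` X i :: (nat \<Rightarrow> nat) set)" for i
      by (intro closed_vimage continuous_on_product_coordinates) (simp add: closed_def open_discrete)
    then have "closed (\<Inter>i. (\<lambda>f. f i) -` X i :: (nat \<Rightarrow> nat) set)"
      by blast
    moreover have "k = (\<Inter>i. (\<lambda>f. f i) -` X i)"
      by (auto simp: X PiE_def Pi_def)
    ultimately show ?thesis by simp
  qed
  \<comment> \<open>Adding the empty set leaves the union unchanged and makes the family nonempty,
    so that a sequence can enumerate it even when \<open>L\<close> is empty.\<close>
  have "countable (insert {} L)"
    using K(2) L(1) by (simp add: countable_subset)
  then have range: "range (from_nat_into (insert {} L)) = insert {} L"
    by (intro range_from_nat_into) auto
  show thesis
  proof (rule that)
    fix n
    have "from_nat_into (insert {} L) n \<in> insert {} K"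
      using range L(1) by blast
    then show "open (from_nat_into (insert {} L) n)" "closed (from_nat_into (insert {} L) n)"
      using closed topological_basis_open[OF K(1)] by (metis insertE open_empty closed_empty)+
  next
    show "A = (\<Union>n. from_nat_into (insert {} L) n)"
      using range L(2) by simp
  qed
qed

text \<open>Above index 1 the same union serves, since indices below \<xi> are below \<zeta>. An
  open set has no such union at hand; its clopen pieces supply one, with all indices 1.\<close>

lemma is_Sigma0_mono:
  fixes A :: "(nat \<Rightarrow> nat) set"
  assumes "is_Sigma0 \<xi> A" "\<xi> \<le> \<zeta>"
  shows "is_Sigma0 \<zeta> A"
proof (cases "\<xi> = \<zeta>")
  case False
  with assms have less: "\<xi> < \<zeta>" by simp
  with is_Sigma0_one_le[OF assms(1)] have \<zeta>: "1 < \<zeta>" by simp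
  from assms(1) show ?thesis
  proof cases
    case is_Sigma0_open
    obtain C :: "nat \<Rightarrow> (nat \<Rightarrow> nat) set" where C: "\<And>n. closed (C n)" "A = (\<Union>n. C n)"
      using open_eq_Union_clopen[OF \<open>open A\<close>] by blast
    show ?thesis
      unfolding C(2) using C(1) \<zeta>
      by (intro is_Sigma0.is_Sigma0_Union[where \<eta> = "\<lambda>_. 1"]) (auto simp: is_Sigma0_one_iff)
  next
    case (is_Sigma0_Union \<eta> B)
    show ?thesis
      unfolding \<open>A = _\<close>
      by (rule is_Sigma0.is_Sigma0_Union[OF \<zeta>, of \<eta>]) (use is_Sigma0_Union less in \<open>auto intro: less_trans[OF _ less]\<close>)
  qed
qed (use assms in simp)

text \<open>Above index 1 the double union of the pieces is flattened by the pairing function into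
  one sequence, each piece keeping its own index.\<close>

lemma is_Sigma0_UN:
  assumes "1 \<le> \<xi>" "\<And>n::nat. is_Sigma0 \<xi> (A n)"
  shows "is_Sigma0 \<xi> (\<Union>n. A n)"
proof (cases "\<xi> = 1")
  case True
  with assms show ?thesis by (auto simp: is_Sigma0_one_iff)
next
  case False
  with assms have \<xi>: "1 < \<xi>" by simp
  have "\<exists>B \<eta>. A n = (\<Union>m::nat. B m) \<and> (\<forall>m. 1 \<le> \<eta> m \<and> \<eta> m < \<xi> \<and> is_Sigma0 (\<eta> m) (- B m))" for n
    by (rule is_Sigma0_gt_one_cases[OF assms(2)[of n] \<xi>]) blast
  then obtain B \<eta> where B: "\<And>n. A n = (\<Union>m::nat. B n m)"
    "\<And>n m. 1 \<le> \<eta> n m \<and> \<eta> n m < \<xi> \<and> is_Sigma0 (\<eta> n m) (- B n m)"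
    by metis
  have "B n m \<subseteq> (\<Union>k. case_prod B (prod_decode k))" for n m
    using UN_upper[of "prod_encode (n, m)" UNIV "\<lambda>k. case_prod B (prod_decode k)"] by simp
  moreover have "case_prod B (prod_decode k) \<subseteq> (\<Union>n. \<Union>m. B n m)" for k
    by (cases "prod_decode k") auto
  ultimately have "(\<Union>n. A n) = (\<Union>k. case_prod B (prod_decode k))"
    unfolding B(1) by (intro equalityI UN_least)
  moreover have "is_Sigma0 \<xi> \<dots>"
    by (rule is_Sigma0_Union[OF \<xi>, of "\<lambda>k. case_prod \<eta> (prod_decode k)"]) (use B(2) in \<open>auto split: prod.splits\<close>)
  ultimately show ?thesis by simp
qed

lemma is_Sigma0_empty: "1 \<le> \<xi> \<Longrightarrow> is_Sigma0 \<xi> {}"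
  using is_Sigma0_compl[of 1 "{}" \<xi>] by (auto simp: le_less is_Sigma0_one_iff)

lemma is_Sigma0_Un:
  assumes "is_Sigma0 \<xi> A" "is_Sigma0 \<xi> B"
  shows "is_Sigma0 \<xi> (A \<union> B)"
proof -
  have "A \<union> B = (\<Union>n::nat. if n = 0 then A else B)"
    by (auto split: if_splits)
  moreover have "is_Sigma0 \<xi> \<dots>"
    using assms is_Sigma0_one_le by (intro is_Sigma0_UN) auto
  ultimately show ?thesis by simp
qed

text \<open>Intersection distributes over the two unions. The complement of a piece
  \<open>A' n \<inter> B' m\<close> is a union of two sets that can be raised to the common index
  \<open>max (\<alpha> n) (\<beta> m)\<close>, still below \<xi>.\<close>

lemma is_Sigma0_Int:
  fixes A B :: "(nat \<Rightarrow> nat) set"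
  assumes "is_Sigma0 \<xi> A" "is_Sigma0 \<xi> B"
  shows "is_Sigma0 \<xi> (A \<inter> B)"
proof (cases "\<xi> = 1")
  case True
  with assms show ?thesis by (auto simp: is_Sigma0_one_iff)
next
  case False
  have \<xi>: "1 \<le> \<xi>" "1 < \<xi>"
    using False is_Sigma0_one_le[OF assms(1)] by auto
  obtain A' \<alpha> where A: "A = (\<Union>n::nat. A' n)"
    "\<And>n. 1 \<le> \<alpha> n" "\<And>n. \<alpha> n < \<xi>" "\<And>n. is_Sigma0 (\<alpha> n) (- A' n)"
    using is_Sigma0_gt_one_cases[OF assms(1) \<xi>(2)] by blast
  obtain B' \<beta> where B: "B = (\<Union>n::nat. B' n)"
    "\<And>n. 1 \<le> \<beta> n" "\<And>n. \<beta> n < \<xi>" "\<And>n. is_Sigma0 (\<beta> n) (- B' n)"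
    using is_Sigma0_gt_one_cases[OF assms(2) \<xi>(2)] by blast
  have "is_Sigma0 \<xi> (A' n \<inter> B' m)" for n m
  proof (rule is_Sigma0_compl)
    show "is_Sigma0 (max (\<alpha> n) (\<beta> m)) (- (A' n \<inter> B' m))"
      unfolding Compl_Int
      by (intro is_Sigma0_Un; rule is_Sigma0_mono[OF A(4)] is_Sigma0_mono[OF B(4)]) auto
    show "max (\<alpha> n) (\<beta> m) < \<xi>"
      using A(3) B(3) by simp
  qed
  then have "is_Sigma0 \<xi> (\<Union>n. \<Union>m. A' n \<inter> B' m)"
    by (intro is_Sigma0_UN \<xi>)
  moreover have "A \<inter> B = (\<Union>n. \<Union>m. A' n \<inter> B' m)"
    unfolding A(1) B(1) by blast
  ultimately show ?thesis by simp
qed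

lemma Delta0_iff: "A \<in> Delta0 \<xi> \<longleftrightarrow> is_Sigma0 \<xi> A \<and> is_Sigma0 \<xi> (- A)"
  by (simp add: Delta0_def Pi0_def Sigma0_def)

lemma Delta0_Compl: "A \<in> Delta0 \<xi> \<Longrightarrow> - A \<in> Delta0 \<xi>"
  by (simp add: Delta0_iff)

lemma Delta0_Un: "A \<in> Delta0 \<xi> \<Longrightarrow> B \<in> Delta0 \<xi> \<Longrightarrow> A \<union> B \<in> Delta0 \<xi>"
  for A B :: "(nat \<Rightarrow> nat) set"
  by (simp add: Delta0_iff is_Sigma0_Un is_Sigma0_Int)

lemma Delta0_Int: "A \<in> Delta0 \<xi> \<Longrightarrow> B \<in> Delta0 \<xi> \<Longrightarrow> A \<inter> B \<in> Delta0 \<xi>"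
  for A B :: "(nat \<Rightarrow> nat) set"
  by (simp add: Delta0_iff is_Sigma0_Un is_Sigma0_Int)

lemma Delta0_UNIV: "1 \<le> \<xi> \<Longrightarrow> UNIV \<in> Delta0 \<xi>"
  using is_Sigma0_compl[of 1 UNIV \<xi>] by (auto simp: le_less Delta0_iff is_Sigma0_empty is_Sigma0_one_iff)

lemma Delta0_mono: "A \<in> Delta0 \<xi> \<Longrightarrow> \<xi> \<le> \<zeta> \<Longrightarrow> A \<in> Delta0 \<zeta>"
  for A :: "(nat \<Rightarrow> nat) set"
  by (simp add: Delta0_iff is_Sigma0_mono[of \<xi> _ \<zeta>])

section \<open>Successor levels and unions of lower ambiguous sets\<close>

lemma Delta0_osuc_if_is_Sigma0:
  fixes A :: "(nat \<Rightarrow> nat) set"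
  assumes "is_Sigma0 \<xi> A"
  shows "A \<in> Delta0 (osuc \<xi>)"
  using assms less_osuc[of \<xi>] is_Sigma0_compl[of \<xi> "- A" "osuc \<xi>"] is_Sigma0_mono[of \<xi> A "osuc \<xi>"]
  by (simp add: Delta0_iff)

text \<open>Indices below \<open>osuc \<xi>\<close> are at most \<xi>, so monotonicity raises all of
  them to \<xi> itself.\<close>

lemma is_Sigma0_osuc_iff:
  fixes A :: "(nat \<Rightarrow> nat) set"
  assumes "1 \<le> \<xi>"
  shows "is_Sigma0 (osuc \<xi>) A \<longleftrightarrow> (\<exists>B. A = (\<Union>n::nat. B n) \<and> (\<forall>n. is_Sigma0 \<xi> (- B n)))"
proof
  assume A: "is_Sigma0 (osuc \<xi>) A"
  have "1 < osuc \<xi>" using assms by (simp add: less_osuc_iff)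
  from is_Sigma0_gt_one_cases[OF A this] obtain B \<eta> where B: "A = (\<Union>n::nat. B n)"
    "\<And>n. \<eta> n \<le> \<xi>" "\<And>n. is_Sigma0 (\<eta> n) (- B n)"
    unfolding less_osuc_iff by metis
  have "is_Sigma0 \<xi> (- B n)" for n
    using B(3,2) by (rule is_Sigma0_mono)
  with B(1) show "\<exists>B. A = (\<Union>n::nat. B n) \<and> (\<forall>n. is_Sigma0 \<xi> (- B n))"
    by blast
next
  assume "\<exists>B. A = (\<Union>n::nat. B n) \<and> (\<forall>n. is_Sigma0 \<xi> (- B n))"
  then obtain B where B: "A = (\<Union>n::nat. B n)" "\<And>n. is_Sigma0 \<xi> (- B n)"
    by blast
  show "is_Sigma0 (osuc \<xi>) A"
    unfolding B(1) by (intro is_Sigma0_UN one_le_osuc is_Sigma0_compl[OF B(2) less_osuc])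
qed

text \<open>For \<mu> = 1 the pieces are clopen and \<nu> = 0 works. Otherwise the pieces of the
  defining union have complements at index \<open>\<eta> n\<close>, hence are ambiguous one level
  up, and \<nu> = \<open>\<eta> n\<close>.\<close>

lemma is_Sigma0_eq_Union_Delta0:
  fixes A :: "(nat \<Rightarrow> nat) set"
  assumes "is_Sigma0 \<mu> A"
  obtains C :: "nat \<Rightarrow> (nat \<Rightarrow> nat) set"
    where "A = (\<Union>n. C n)" "\<And>n. \<exists>\<nu><\<mu>. C n \<in> Delta0 (osuc \<nu>)"
  using assms
proof cases
  case is_Sigma0_open
  obtain C :: "nat \<Rightarrow> (nat \<Rightarrow> nat) set" where C: "\<And>n. open (C n)" "\<And>n. closed (C n)" "A = (\<Union>n. C n)"
    using open_eq_Union_clopen[OF \<open>open A\<close>] by blast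
  have "\<exists>\<nu><\<mu>. C n \<in> Delta0 (osuc \<nu>)" for n
  proof (intro exI conjI)
    show "0 < \<mu>"
      using is_Sigma0_open(1) less_osuc[of 0] by (simp add: one_omega1_def)
    show "C n \<in> Delta0 (osuc 0)"
      using C(1,2)[of n]
      unfolding one_omega1_def[symmetric] Delta0_iff is_Sigma0_one_iff closed_def by blast
  qed
  with C(3) show thesis by (rule that)
next
  case (is_Sigma0_Union \<eta> B)
  have "\<exists>\<nu><\<mu>. B n \<in> Delta0 (osuc \<nu>)" for n
  proof (intro exI conjI)
    show "\<eta> n < \<mu>"
      using is_Sigma0_Union(3) by blast
    have "is_Sigma0 (\<eta> n) (- B n)"
      using is_Sigma0_Union(3) by blast
    from Delta0_Compl[OF Delta0_osuc_if_is_Sigma0[OF this]] show "B n \<in> Delta0 (osuc (\<eta> n))"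
      unfolding double_compl .
  qed
  with \<open>A = _\<close> show thesis by (rule that)
qed

section \<open>From guessability to the Borel class\<close>

lemma initial_segment_Suc: "initial_segment s (Suc n) = initial_segment s n @ [s n]"
  by (simp add: initial_segment_def)

text \<open>The set is a finite Boolean combination of the first \<open>n\<close> sets, built by
  splitting on the last bit. The induction generalises \<open>P\<close> so that this bit can be
  absorbed into the predicate.\<close>

lemma Delta0_Collect_initial_segment:
  fixes \<S> :: "nat \<Rightarrow> (nat \<Rightarrow> nat) set"
  assumes "1 \<le> \<xi>" "\<And>i. i < n \<Longrightarrow> \<S> i \<in> Delta0 \<xi>"
  shows "{f. P (initial_segment (char_seq \<S> f) n)} \<in> Delta0 \<xi>"
  using assms(2)
proof (induction n arbitrary: P)
  case 0
  show ?case
    using Delta0_UNIV[OF assms(1)] Delta0_Compl[OF Delta0_UNIV[OF assms(1)]]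
    by (cases "P []") (simp_all add: initial_segment_def)
next
  case (Suc n)
  let ?I = "\<lambda>b. {f. P (initial_segment (char_seq \<S> f) n @ [b])}"
  have "f \<in> {f. P (initial_segment (char_seq \<S> f) (Suc n))} \<longleftrightarrow>
      f \<in> (\<S> n \<inter> ?I True) \<union> (- \<S> n \<inter> ?I False)" for f
    by (cases "f \<in> \<S> n") (simp_all add: initial_segment_Suc char_seq_def char_fun_def)
  then have "{f. P (initial_segment (char_seq \<S> f) (Suc n))} = (\<S> n \<inter> ?I True) \<union> (- \<S> n \<inter> ?I False)"
    by blast
  moreover have "?I b \<in> Delta0 \<xi>" for b
    using Suc.IH[of "\<lambda>l. P (l @ [b])"] Suc.prems by simp
  ultimately show ?case
    using Suc.prems[of n] by (auto intro!: Delta0_Un Delta0_Int Delta0_Compl)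
qed

text \<open>As \<nu> < \<mu> gives \<open>osuc \<nu> \<le> \<mu>\<close>, every
  \<open>\<S> i\<close> lies in \<open>Delta0 \<mu>\<close>, and so does each condition at a fixed
  time. Its tail intersections are then complements of sets at index \<mu>, and the union over
  starting times costs one level.\<close>

lemma is_Sigma0_eventually_guess:
  fixes \<S> :: "nat \<Rightarrow> (nat \<Rightarrow> nat) set"
  assumes \<mu>: "1 \<le> \<mu>" and \<S>: "\<And>i. \<exists>\<nu><\<mu>. \<S> i \<in> Delta0 (osuc \<nu>)"
  shows "is_Sigma0 (osuc \<mu>) {f. \<forall>\<^sub>F n in sequentially. P (initial_segment (char_seq \<S> f) n)}"
proof -
  let ?Q = "\<lambda>n. {f. P (initial_segment (char_seq \<S> f) n)}"
  have "\<S> i \<in> Delta0 \<mu>" for i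
  proof -
    obtain \<nu> where \<nu>: "\<nu> < \<mu>" "\<S> i \<in> Delta0 (osuc \<nu>)" using \<S> by blast
    then have "osuc \<nu> \<le> \<mu>" by (simp add: osuc_le_iff)
    with \<nu>(2) show ?thesis by (rule Delta0_mono)
  qed
  then have "?Q n \<in> Delta0 \<mu>" for n
    by (intro Delta0_Collect_initial_segment \<mu>)
  then have "is_Sigma0 \<mu> (- ?Q n)" for n
    by (simp add: Delta0_iff)
  then have "is_Sigma0 \<mu> (\<Union>k. - ?Q (n + k))" for n
    by (intro is_Sigma0_UN \<mu>)
  then have "is_Sigma0 \<mu> (- (\<Inter>k. ?Q (n + k)))" for n
    by (simp only: Compl_INT)
  moreover have "{f. \<forall>\<^sub>F n in sequentially. P (initial_segment (char_seq \<S> f) n)} = (\<Union>n. \<Inter>k. ?Q (n + k))"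
    by (auto simp: eventually_sequentially le_iff_add)
  ultimately show ?thesis
    unfolding is_Sigma0_osuc_iff[OF \<mu>] by (intro exI conjI allI)
qed

lemma guessable_of_order_imp_Delta0:
  assumes \<mu>: "1 \<le> \<mu>" and "guessable_of_order \<mu> S"
  shows "S \<in> Delta0 (osuc \<mu>)"
proof -
  obtain \<S> G where \<S>: "\<And>i. \<exists>\<nu><\<mu>. \<S> i \<in> Delta0 (osuc \<nu>)"
    and G: "\<And>f. \<forall>\<^sub>F n in sequentially. G (initial_segment (char_seq \<S> f) n) = (f \<in> S)"
    using assms(2)
    unfolding guessable_of_order_def guessable_based_on_def tendsto_discrete char_fun_def by blast
  \<comment> \<open>Because the guesses converge on every \<open>f\<close>, they are eventually
    \<open>b\<close> only if \<open>b\<close> is the limit. So the set and its complement are both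
    given by an eventual condition.\<close>
  have "{f. \<forall>\<^sub>F n in sequentially. G (initial_segment (char_seq \<S> f) n) = b} = {f. (f \<in> S) = b}" for b
  proof -
    have "(\<forall>\<^sub>F n in sequentially. G (initial_segment (char_seq \<S> f) n) = b) \<longleftrightarrow> (f \<in> S) = b" for f
    proof
      assume "\<forall>\<^sub>F n in sequentially. G (initial_segment (char_seq \<S> f) n) = b"
      with G[of f] have "\<forall>\<^sub>F n::nat in sequentially. (f \<in> S) = b"
        by eventually_elim simp
      then show "(f \<in> S) = b" by simp
    qed (use G[of f] in simp)
    then show ?thesis by simp
  qed
  then have "is_Sigma0 (osuc \<mu>) {f. (f \<in> S) = b}" for b
    using is_Sigma0_eventually_guess[OF \<mu>, of \<S> "\<lambda>l. G l = b"] \<S> by simp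
  from this[of True] this[of False] show ?thesis
    by (simp add: Delta0_iff Compl_eq)
qed

section \<open>From the Borel class to a guesser\<close>

lemma Delta0_imp_guessable_of_order:
  assumes \<mu>: "1 \<le> \<mu>" and S: "S \<in> Delta0 (osuc \<mu>)"
  shows "guessable_of_order \<mu> S"
proof -
  obtain A B where A: "S = (\<Union>n::nat. A n)" "\<And>n. is_Sigma0 \<mu> (- A n)"
    and B: "- S = (\<Union>n::nat. B n)" "\<And>n. is_Sigma0 \<mu> (- B n)"
    using S unfolding Delta0_iff is_Sigma0_osuc_iff[OF \<mu>] by blast
  define E where "E i = (if even i then A else B) (i div 2)" for i
  \<comment> \<open>Membership in some \<open>C i k\<close> is a witness that \<open>f\<close> is
    not in \<open>E i\<close>, and each such test is of a lower class.\<close>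
  have "\<exists>C :: nat \<Rightarrow> _. - E i = (\<Union>k. C k) \<and> (\<forall>k. \<exists>\<nu><\<mu>. C k \<in> Delta0 (osuc \<nu>))" for i
    by (rule is_Sigma0_eq_Union_Delta0[of \<mu> "- E i"]) (use A(2) B(2) in \<open>auto simp: E_def\<close>)
  then obtain C :: "nat \<Rightarrow> nat \<Rightarrow> _" where
    C: "\<And>i. - E i = (\<Union>k. C i k)" "\<And>i k. \<exists>\<nu><\<mu>. C i k \<in> Delta0 (osuc \<nu>)"
    by metis
  \<comment> \<open>Pairing lists all tests for all \<open>i\<close> in one sequence.\<close>
  define \<S> where "\<S> j = (case prod_decode j of (i, k) \<Rightarrow> C i k)" for j
  \<comment> \<open>The length bound restricts to the tests already answered, so on growing segments
    of one sequence a refutation is never withdrawn.\<close>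
  define refuted :: "nat \<Rightarrow> bool list \<Rightarrow> bool"
    where "refuted i l \<longleftrightarrow> (\<exists>k. prod_encode (i, k) < length l \<and> l ! prod_encode (i, k))" for i l
  have refuted_iff: "refuted i (initial_segment (char_seq \<S> f) n) \<longleftrightarrow>
      (\<exists>k. prod_encode (i, k) < n \<and> f \<in> C i k)" for i f n
    by (auto simp: refuted_def initial_segment_def char_seq_def char_fun_def \<S>_def)
  have "\<forall>\<^sub>F n in sequentially. even (LEAST i. \<not> refuted i (initial_segment (char_seq \<S> f) n)) = (f \<in> S)" for f
  proof -
    define m where "m = (LEAST i. f \<in> E i)"
    have "\<exists>i. f \<in> E i"
    proof (cases "f \<in> S")
      case True
      then obtain n where "f \<in> A n" using A(1) by blast
      then have "f \<in> E (2 * n)" by (simp add: E_def)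
      then show ?thesis ..
    next
      case False
      then obtain n where "f \<in> B n" using B(1) by blast
      then have "f \<in> E (2 * n + 1)" by (simp add: E_def)
      then show ?thesis ..
    qed
    then have m: "f \<in> E m"
      unfolding m_def by (rule LeastI_ex)
    \<comment> \<open>Each wrong index below \<open>m\<close> is refuted as soon as the position of
      one of its witnesses has been read.\<close>
    have below: "\<forall>\<^sub>F n in sequentially. refuted i (initial_segment (char_seq \<S> f) n)" if "i < m" for i
    proof -
      have "f \<in> - E i" using that not_less_Least unfolding m_def by blast
      then obtain k where "f \<in> C i k" using C(1) by blast
      then have "refuted i (initial_segment (char_seq \<S> f) n)" if "prod_encode (i, k) < n" for n
        using that unfolding refuted_iff by blast
      then show ?thesis
        by (rule eventually_mono[OF eventually_gt_at_top])
    qed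
    \<comment> \<open>Only finitely many indices lie below \<open>m\<close>, so one threshold serves
      them all.\<close>
    have "\<forall>\<^sub>F n in sequentially. \<forall>i\<in>{..<m}. refuted i (initial_segment (char_seq \<S> f) n)"
      by (intro eventually_ball_finite) (use below in auto)
    then show ?thesis
    proof eventually_elim
      case (elim n)
      \<comment> \<open>Since \<open>f\<close> lies in \<open>E m\<close>, it meets no
        \<open>C m k\<close>; hence \<open>m\<close> survives at every stage.\<close>
      have "\<not> refuted m (initial_segment (char_seq \<S> f) n)"
        using m C(1)[of m] by (auto simp: refuted_iff)
      with elim have "(LEAST i. \<not> refuted i (initial_segment (char_seq \<S> f) n)) = m"
        by (intro Least_equality) (auto simp: not_less[symmetric])
      \<comment> \<open>The parity of \<open>m\<close> tells whether \<open>E m\<close> is one of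
        the pieces of \<open>S\<close> or of its complement.\<close>
      moreover have "even m \<longleftrightarrow> f \<in> S"
        using m A(1) B(1) unfolding E_def by (auto split: if_splits)
      ultimately show ?case by simp
    qed
  qed
  then have "guessable_based_on S \<S>"
    unfolding guessable_based_on_def tendsto_discrete char_fun_def
    by (intro exI[of _ "\<lambda>l. even (LEAST i. \<not> refuted i l)"]) simp
  moreover have "\<exists>\<nu><\<mu>. \<S> j \<in> Delta0 (osuc \<nu>)" for j
    using C(2) by (simp add: \<S>_def split: prod.split)
  ultimately show ?thesis
    unfolding guessable_of_order_def by blast
qed

theorem theorem5p4:
  fixes \<mu> :: omega1 and S :: "(nat \<Rightarrow> nat) set"
  assumes "1 \<le> \<mu>"
  shows "guessable_of_order \<mu> S \<longleftrightarrow> S \<in> Delta0 (osuc \<mu>)"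
  using guessable_of_order_imp_Delta0[OF assms] Delta0_imp_guessable_of_order[OF assms] by blast

end
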